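(* Let $S=(b+\mathbb{Z}^n)\cap Q$, where $b\in\mathbb{R}^n\setminus\mathbb{Z}^n$ and $Q\subseteq\mathbb{R}^n$ is a rational polyhedron. Let $B$ be a maximal $S$-free convex $0$-neighborhood with smallest representation $\psi$, and let $t\in\mathbb{R}^n$ be such that $0\in\operatorname{int}(B+t)$ (thus $B+t$ is a maximal $(S+t)$-free convex $0$-neighborhood). For $p^*\in\mathbb{R}^n$ and $\hat p:=p^*+V_\psi(p^* )t\in\mathbb{R}^n$, $$\mathcal{X}(B,p^* )+W_S=\mathbb{R}^n\quad\text{if and only if}\quad\mathcal{X}(B+t,\hat p)+W_{S+t}=\mathbb{R}^n,$$ where $\mathcal{X}(B,p^* )$ is formed with respect to $S$ and $\mathcal{X}(B+t,\hat p)$ is formed with respect to $S+t$.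
   Context: $\mathbb{Z}_+$, $\mathbb{R}_+$ denote nonnegative integers and reals. All notions below are defined for a set $T$ (used for $T=S$ and $T=S+t$), which is closed and does not contain $0$. For $k,\ell\in\mathbb{Z}_+$ (not both $0$), $R\in\mathbb{R}^{n\times k}$, $P\in\mathbb{R}^{n\times\ell}$, let $X_T(R,P)=\{(s,y)\in\mathbb{R}^k_+\times\mathbb{Z}^\ell_+: Rs+Py\in T\}$. A pair of functions $\psi,\pi:\mathbb{R}^n\to\mathbb{R}$ is a valid pair for $T$ if for all $k,\ell$, $R=(r^1,\dots,r^k)$, $P=(p^1,\dots,p^\ell)$, the inequality $\sum_i\psi(r^i)s_i+\sum_j\pi(p^j)y_j\ge1$ holds for all $(s,y)\in X_T(R,P)$. A lifting of $\psi$ (w.r.t. $T$) is a $\pi:\mathbb{R}^n\to\mathbb{R}$ such that $(\psi,\pi)$ is a valid pair for $T$; a minimal lifting is one minimal under pointwise order among liftings. $V_\psi(p):=\inf\{\pi(p):\pi\text{ a minimal lifting of }\psi\}$ for $p\in\mathbb{R}^n$. A convex set $C\subseteq\mathbb{R}^n$ with $0\in\operatorname{int}(C)$ and $T\cap\operatorname{int}(C)=\emptyset$ is a $T$-free convex $0$-neighborhood; it is maximal if no strict superset of it is a $T$-free convex $0$-neighborhood. The maximal ones considered are polyhedra $C=\{r: c^i\cdot r\le1\ \forall i\in I\}$ with $I$ a finite set indexing the facets of $C$; the smallest representation of $C$ is $\psi_C(r)=\max_{i\in I}c^i\cdot r$. (If $B=\{r:a^i\cdot r\le 1\ \forall i\in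 I\}$, then $B+t=\{r:a^i_t\cdot r\le 1\ \forall i\in I\}$ with $a^i_t=a^i/(1+a^i\cdot t)$.) For $p\in\mathbb{R}^n$ and $V:=V_{\psi_C}(p)$ (computed w.r.t. $T$), let $\Delta_{C,p}:=\{(r,r_{n+1})\in\mathbb{R}^n\times\mathbb{R}_+: c^i\cdot r+(V-c^i\cdot p)r_{n+1}\le1\ \forall i\in I\}$. For $x\in\mathbb{R}^n$ the spindle is $R_C(x):=\{r\in\mathbb{R}^n:(c^i-c^k)\cdot r\le0\text{ and }(c^i-c^k)\cdot(x-r)\le0\ \forall i\in I\}$, where $k\in I$ is an index with $\psi_C(x)=c^k\cdot x$. Then $$\mathcal{X}(C,p):=\bigcup_{(\bar x,\bar x_{n+1})\in\Delta_{C,p}\cap(T\times\mathbb{Z}_+)}\ \bigcup_{i=0}^{\bar x_{n+1}}\big(R_C(\bar x-\bar x_{n+1}p)+ip\big).$$ Also $W_T:=\{w\in\mathbb{R}^n: s+\lambda w\in T\ \forall s\in T,\ \forall\lambda\in\mathbb{Z}\}$. *)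

theory Defs
  imports "HOL-Analysis.Analysis"
begin

definition integer_vectors :: "(real ^ 'n) set" where
  "integer_vectors = {z. \<forall>i. z $ i \<in> \<int>}"

definition rational_polyhedron :: "(real ^ 'n) set \<Rightarrow> bool" where
  "rational_polyhedron Q \<longleftrightarrow>
     (\<exists>F :: ((real ^ 'n) \<times> real) set.
        finite F \<and> (\<forall>(a, \<beta>) \<in> F. (\<forall>i. a $ i \<in> \<rat>) \<and> \<beta> \<in> \<rat>) \<and>
        Q = {x. \<forall>(a, \<beta>) \<in> F. a \<bullet> x \<le> \<beta>})"


subsection \<open>Valid pairs and liftings\<close>

text \<open>
  The numbers of columns vary inside the definition of a valid pair, so a matrix with \<open>k\<close> columns
  is a function on indices of which only the values below \<open>k\<close> matter; likewise for \<open>s\<close> and \<open>y\<close>.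
\<close>

definition mixed_integer_set ::
    "(real ^ 'n) set \<Rightarrow> nat \<Rightarrow> nat \<Rightarrow> (nat \<Rightarrow> real ^ 'n) \<Rightarrow> (nat \<Rightarrow> real ^ 'n) \<Rightarrow>
     ((nat \<Rightarrow> real) \<times> (nat \<Rightarrow> nat)) set" where
  "mixed_integer_set T k l R P =
     {(s, y). (\<forall>i<k. 0 \<le> s i) \<and>
              (\<Sum>i<k. s i *\<^sub>R R i) + (\<Sum>j<l. real (y j) *\<^sub>R P j) \<in> T}"

definition valid_pair ::
    "(real ^ 'n) set \<Rightarrow> (real ^ 'n \<Rightarrow> real) \<Rightarrow> (real ^ 'n \<Rightarrow> real) \<Rightarrow> bool" where
  "valid_pair T \<psi> \<pi> \<longleftrightarrow>
     (\<forall>k l R P. \<not> (k = 0 \<and> l = 0) \<longrightarrow>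
        (\<forall>(s, y) \<in> mixed_integer_set T k l R P.
           (\<Sum>i<k. \<psi> (R i) * s i) + (\<Sum>j<l. \<pi> (P j) * real (y j)) \<ge> 1))"

definition lifting ::
    "(real ^ 'n) set \<Rightarrow> (real ^ 'n \<Rightarrow> real) \<Rightarrow> (real ^ 'n \<Rightarrow> real) \<Rightarrow> bool" where
  "lifting T \<psi> \<pi> \<longleftrightarrow> valid_pair T \<psi> \<pi>"

definition minimal_lifting ::
    "(real ^ 'n) set \<Rightarrow> (real ^ 'n \<Rightarrow> real) \<Rightarrow> (real ^ 'n \<Rightarrow> real) \<Rightarrow> bool" where
  "minimal_lifting T \<psi> \<pi> \<longleftrightarrow>
     lifting T \<psi> \<pi> \<and> (\<forall>\<pi>'. lifting T \<psi> \<pi>' \<and> (\<forall>r. \<pi>' r \<le> \<pi> r) \<longrightarrow> \<pi>' = \<pi>)"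

definition V_lift :: "(real ^ 'n) set \<Rightarrow> (real ^ 'n \<Rightarrow> real) \<Rightarrow> real ^ 'n \<Rightarrow> real" where
  "V_lift T \<psi> p = Inf {\<pi> p | \<pi>. minimal_lifting T \<psi> \<pi>}"


subsection \<open>Maximal \<open>T\<close>-free convex neighborhoods of the origin\<close>

definition free_convex_nbhd :: "(real ^ 'n) set \<Rightarrow> (real ^ 'n) set \<Rightarrow> bool" where
  "free_convex_nbhd T C \<longleftrightarrow> convex C \<and> 0 \<in> interior C \<and> T \<inter> interior C = {}"

definition maximal_free_convex_nbhd :: "(real ^ 'n) set \<Rightarrow> (real ^ 'n) set \<Rightarrow> bool" where
  "maximal_free_convex_nbhd T C \<longleftrightarrow>
     free_convex_nbhd T C \<and> \<not> (\<exists>D. free_convex_nbhd T D \<and> C \<subset> D)"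

text \<open>
  The vectors \<open>c\<^sup>i\<close>. For a polyhedron with the origin in its interior each facet spans
  exactly one hyperplane of the form \<open>{r. c \<bullet> r = 1}\<close>, so the facets can be indexed by
  their normals; see \<open>facet_normals_rep\<close> below.
\<close>

definition facet_normals :: "(real ^ 'n) set \<Rightarrow> (real ^ 'n) set" where
  "facet_normals C = {c. (\<forall>r\<in>C. c \<bullet> r \<le> 1) \<and> {r \<in> C. c \<bullet> r = 1} facet_of C}"

definition smallest_rep :: "(real ^ 'n) set \<Rightarrow> real ^ 'n \<Rightarrow> real" where
  "smallest_rep C r = Max ((\<lambda>c. c \<bullet> r) ` facet_normals C)"

lemma hyperplane_one_inject:
  fixes c d :: "'a::euclidean_space"
  assumes "{x. c \<bullet> x = 1} = {x. d \<bullet> x = 1}" "c \<noteq> 0" "d \<noteq> 0"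
  shows "c = d"
proof -
  have iff: "c \<bullet> x = 1 \<longleftrightarrow> d \<bullet> x = 1" for x
    using assms(1) by blast
  have "d \<bullet> c = c \<bullet> c" "c \<bullet> d = d \<bullet> d"
    using iff[of "(1 / (c \<bullet> c)) *\<^sub>R c"] iff[of "(1 / (d \<bullet> d)) *\<^sub>R d"] assms(2,3)
    by (simp_all add: field_simps)
  then have "(c - d) \<bullet> (c - d) = 0"
    by (simp add: inner_diff_left inner_diff_right inner_commute)
  then show ?thesis by simp
qed

lemma facet_normal_unique:
  fixes C :: "(real ^ 'n) set"
  assumes "interior C \<noteq> {}" "c \<in> facet_normals C" "d \<in> facet_normals C"
    and eq: "{r \<in> C. c \<bullet> r = 1} = {r \<in> C. d \<bullet> r = 1}"
  shows "c = d"
proof -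
  have *: "affine hull {r \<in> C. e \<bullet> r = 1} = {x. e \<bullet> x = 1} \<and> e \<noteq> 0"
    if "e \<in> facet_normals C" for e
  proof -
    let ?F = "{r \<in> C. e \<bullet> r = 1}"
    have F: "?F facet_of C" using that by (simp add: facet_normals_def)
    then have ne: "?F \<noteq> {}" by (simp add: facet_of_def)
    then have e: "e \<noteq> 0" by auto
    have dimC: "aff_dim C = int (DIM(real ^ 'n))"
      using assms(1) aff_dim_nonempty_interior[of C] by simp
    have "affine hull ?F = {x. e \<bullet> x = 1}"
    proof (rule affine_dim_equal)
      show "affine hull ?F \<subseteq> {x. e \<bullet> x = 1}"
        by (rule hull_minimal) (auto simp: affine_hyperplane)
      show "aff_dim (affine hull ?F) = aff_dim {x. e \<bullet> x = 1}"
        using F e dimC by (simp add: facet_of_def aff_dim_hyperplane)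
    qed (use ne in \<open>auto simp: affine_hyperplane\<close>)
    with e show ?thesis by simp
  qed
  show ?thesis
    using *[OF assms(2)] *[OF assms(3)] eq by (metis hyperplane_one_inject)
qed

lemma facet_normals_rep:
  fixes C :: "(real ^ 'n) set"
  assumes "polyhedron C" "0 \<in> interior C"
  shows "finite (facet_normals C)"
    and "C = {r. \<forall>c\<in>facet_normals C. c \<bullet> r \<le> 1}"
    and "bij_betw (\<lambda>c. {r \<in> C. c \<bullet> r = 1}) (facet_normals C) {F. F facet_of C}"
proof -
  have int: "interior C \<noteq> {}" using assms(2) by auto
  have aff: "affine hull C = UNIV"
    using int by (rule affine_hull_nonempty_interior)
  obtain F where "finite F" and seq: "C = affine hull C \<inter> \<Inter>F"
             and faces: "\<And>h. h \<in> F \<Longrightarrow> \<exists>a b. a \<noteq> 0 \<and> h = {x. a \<bullet> x \<le> b}"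
             and min: "\<And>F'. F' \<subset> F \<Longrightarrow> C \<subset> (affine hull C) \<inter> \<Inter>F'"
    using assms by (simp add: polyhedron_Int_affine_minimal) meson
  then obtain a b where ab: "\<And>h. h \<in> F \<Longrightarrow> a h \<noteq> 0 \<and> h = {x. a h \<bullet> x \<le> b h}"
    by metis
  note facets = facet_of_polyhedron_explicit [OF \<open>finite F\<close> seq ab min]
  have pos: "b h > 0" if "h \<in> F" for h
  proof -
    have "C \<subseteq> {x. a h \<bullet> x \<le> b h}" using seq ab[OF that] that by blast
    then have "interior C \<subseteq> {x. a h \<bullet> x < b h}"
      using ab[OF that] interior_mono interior_halfspace_le by metis
    then show ?thesis using assms(2) by auto
  qed
  define c where "c h = (1 / b h) *\<^sub>R a h" for h
  have ch: "a h \<bullet> x \<le> b h \<longleftrightarrow> c h \<bullet> x \<le> 1" "a h \<bullet> x = b h \<longleftrightarrow> c h \<bullet> x = 1" if "h \<in> F" for h x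
    using pos[OF that] by (auto simp: c_def field_simps)
  have Ceq: "C = {x. \<forall>h\<in>F. c h \<bullet> x \<le> 1}"
  proof -
    have "C = \<Inter>F" using seq aff by simp
    moreover have "x \<in> h \<longleftrightarrow> c h \<bullet> x \<le> 1" if "h \<in> F" for h x
      using ab[OF that] ch(1)[OF that, of x] by blast
    ultimately show ?thesis by auto
  qed
  have cN: "c h \<in> facet_normals C" if "h \<in> F" for h
  proof -
    have "C \<inter> {x. a h \<bullet> x = b h} facet_of C" using facets that by blast
    moreover have "C \<inter> {x. a h \<bullet> x = b h} = {r \<in> C. c h \<bullet> r = 1}" using ch that by auto
    ultimately show ?thesis using Ceq that by (auto simp: facet_normals_def)
  qed
  have inj: "inj_on (\<lambda>c. {r \<in> C. c \<bullet> r = 1}) (facet_normals C)"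
    using facet_normal_unique[OF int] by (auto intro!: inj_onI)
  have img: "(\<lambda>c. {r \<in> C. c \<bullet> r = 1}) ` facet_normals C = {F. F facet_of C}"
  proof (intro equalityI subsetI)
    fix G assume "G \<in> {F. F facet_of C}"
    then obtain h where h: "h \<in> F" "G = C \<inter> {x. a h \<bullet> x = b h}" using facets by blast
    then have "G = {r \<in> C. c h \<bullet> r = 1}" using ch by auto
    then show "G \<in> (\<lambda>c. {r \<in> C. c \<bullet> r = 1}) ` facet_normals C" using cN[OF h(1)] by blast
  qed (auto simp: facet_normals_def)
  show "bij_betw (\<lambda>c. {r \<in> C. c \<bullet> r = 1}) (facet_normals C) {F. F facet_of C}"
    using inj img by (simp add: bij_betw_def)
  then show "finite (facet_normals C)"
    using finite_polyhedron_facets[OF assms(1)] bij_betw_finite by blast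
  show "C = {r. \<forall>c\<in>facet_normals C. c \<bullet> r \<le> 1}"
    using cN Ceq by (auto simp: facet_normals_def)
qed


subsection \<open>The covering region\<close>

definition Delta :: "(real ^ 'n) set \<Rightarrow> (real ^ 'n) set \<Rightarrow> real ^ 'n \<Rightarrow> ((real ^ 'n) \<times> real) set" where
  "Delta T C p =
     (let V = V_lift T (smallest_rep C) p in
        {(r, h). 0 \<le> h \<and> (\<forall>c\<in>facet_normals C. c \<bullet> r + (V - c \<bullet> p) * h \<le> 1)})"

text \<open>
  The spindle does not depend on the choice of the maximizing normal (\<open>spindle_eq\<close>).
\<close>

definition spindle :: "(real ^ 'n) set \<Rightarrow> real ^ 'n \<Rightarrow> (real ^ 'n) set" where
  "spindle C x =
     {r. \<exists>d\<in>facet_normals C. smallest_rep C x = d \<bullet> x \<and>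
           (\<forall>c\<in>facet_normals C. (c - d) \<bullet> r \<le> 0 \<and> (c - d) \<bullet> (x - r) \<le> 0)}"

lemma spindle_eq:
  assumes "d \<in> facet_normals C" "smallest_rep C x = d \<bullet> x"
  shows "spindle C x =
           {r. \<forall>c\<in>facet_normals C. (c - d) \<bullet> r \<le> 0 \<and> (c - d) \<bullet> (x - r) \<le> 0}"
proof -
  have "(c - d) \<bullet> r \<le> 0 \<and> (c - d) \<bullet> (x - r) \<le> 0"
    if e: "e \<in> facet_normals C" "smallest_rep C x = e \<bullet> x"
      and r: "\<forall>c\<in>facet_normals C. (c - e) \<bullet> r \<le> 0 \<and> (c - e) \<bullet> (x - r) \<le> 0"
      and c: "c \<in> facet_normals C" for c e r
    using bspec[OF r assms(1)] bspec[OF r c] assms(2) e(2)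
    by (simp add: inner_diff_left inner_diff_right)
  then show ?thesis
    using assms unfolding spindle_def by blast
qed

definition covering_region :: "(real ^ 'n) set \<Rightarrow> (real ^ 'n) set \<Rightarrow> real ^ 'n \<Rightarrow> (real ^ 'n) set" where
  "covering_region T C p =
     (\<Union>(x, m) \<in> {(x, m :: nat). x \<in> T \<and> (x, real m) \<in> Delta T C p}.
        \<Union>i\<in>{0..m}. (\<lambda>r. r + real i *\<^sub>R p) ` spindle C (x - real m *\<^sub>R p))"

definition W_set :: "(real ^ 'n) set \<Rightarrow> (real ^ 'n) set" where
  "W_set T = {w. \<forall>s\<in>T. \<forall>k::int. s + of_int k *\<^sub>R w \<in> T}"

end

theory Submission
  imports Defs
begin

text \<open>
  Let \<open>V = V\<^sub>\<psi>(p)\<close>; it is the least \<open>v\<close> with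
  \<open>\<psi>(z - N p) + N v \<ge> 1\<close> for all \<open>z \<in> S\<close> and \<open>N \<in> \<nat>\<close>, and this description shows that the
  lifting value of \<open>p'\<close> with respect to \<open>B + t\<close> is again \<open>V\<close>. The function
  \<open>\<pi>(u) = inf {\<psi>(u + w - i p) + i V | i \<in> \<nat>, w \<in> W}\<close> takes the value \<open>\<psi>(r) + i V\<close> at each point
  \<open>r + i p + w\<close> of \<open>X(B,p) + W\<close>, which forces \<open>u \<mapsto> u + \<pi>(u) t\<close> to map \<open>X(B,p) + W\<close> into
  \<open>X(B+t,p') + W\<close>. This map preserves the lines parallel to \<open>t\<close>; on each of them it is continuous,
  since \<open>\<pi>\<close> is Lipschitz, and tends to both infinities, since \<open>\<psi>(-t) < 1\<close>. Hence it is surjective,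
  and a covering for \<open>B\<close> yields one for \<open>B + t\<close>. The converse is the same statement for \<open>-t\<close>.
\<close>

subsection \<open>Lifting values of sublinear functions\<close>

definition sublinear :: "('a::real_vector \<Rightarrow> real) \<Rightarrow> bool" where
  "sublinear \<psi> \<longleftrightarrow> (\<forall>x y. \<psi> (x + y) \<le> \<psi> x + \<psi> y) \<and> (\<forall>c x. 0 \<le> c \<longrightarrow> \<psi> (c *\<^sub>R x) = c * \<psi> x)"

lemma sublinear_add: "sublinear \<psi> \<Longrightarrow> \<psi> (x + y) \<le> \<psi> x + \<psi> y"
  by (simp add: sublinear_def)

lemma sublinear_scale: "sublinear \<psi> \<Longrightarrow> 0 \<le> c \<Longrightarrow> \<psi> (c *\<^sub>R x) = c * \<psi> x"
  by (simp add: sublinear_def)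

lemma sublinear_0: "sublinear \<psi> \<Longrightarrow> \<psi> 0 = 0"
  using sublinear_scale[of \<psi> 0 0] by simp

lemma sublinear_sum: "sublinear \<psi> \<Longrightarrow> \<psi> (\<Sum>i\<in>I. f i) \<le> (\<Sum>i\<in>I. \<psi> (f i))"
proof (induction I rule: infinite_finite_induct)
  case (insert x F)
  then show ?case
    using sublinear_add[of \<psi> "f x" "\<Sum>i\<in>F. f i"] by simp
qed (simp_all add: sublinear_0)

section \<open>Values that liftings can take at one point\<close>

definition feasible_value ::
    "(real ^ 'n) set \<Rightarrow> (real ^ 'n \<Rightarrow> real) \<Rightarrow> real ^ 'n \<Rightarrow> real \<Rightarrow> bool" where
  "feasible_value T \<psi> p v \<longleftrightarrow> (\<forall>z\<in>T. \<forall>N::nat. 1 \<le> \<psi> (z - real N *\<^sub>R p) + real N * v)"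

lemma lifting_feasible_value:
  assumes "lifting T \<psi> \<pi>"
  shows "feasible_value T \<psi> p (\<pi> p)"
  unfolding feasible_value_def
proof (intro ballI allI)
  fix z N assume "z \<in> T"
  have "\<forall>(s, y) \<in> mixed_integer_set T 1 1 (\<lambda>_. z - real N *\<^sub>R p) (\<lambda>_. p).
          1 \<le> (\<Sum>i<1::nat. \<psi> (z - real N *\<^sub>R p) * s i) + (\<Sum>j<1::nat. \<pi> p * real (y j))"
    using assms[unfolded lifting_def valid_pair_def, rule_format, of 1 1] by auto
  moreover have "(\<lambda>_. 1, \<lambda>_. N) \<in> mixed_integer_set T 1 1 (\<lambda>_. z - real N *\<^sub>R p) (\<lambda>_. p)"
    using \<open>z \<in> T\<close> by (simp add: mixed_integer_set_def)
  ultimately show "1 \<le> \<psi> (z - real N *\<^sub>R p) + real N * \<pi> p"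
    by (fastforce simp: mult.commute)
qed

lemma lifting_lower_bound:
  assumes "lifting T \<psi> \<pi>" "z \<in> T"
  shows "1 - \<psi> (z - q) \<le> \<pi> q"
proof -
  have "1 \<le> \<psi> (z - real 1 *\<^sub>R q) + real 1 * \<pi> q"
    using lifting_feasible_value[OF assms(1)] assms(2) unfolding feasible_value_def by blast
  then show ?thesis by simp
qed

text \<open>Integer columns equal to \<open>p\<close> are merged into one multiplicity
  \<open>N\<close>; at all other columns the function is \<open>\<psi>\<close> itself, so
  sublinearity lets them be absorbed with the continuous ones. Thus the necessary condition of
  \<open>lifting_feasible_value\<close> is also sufficient.\<close>

lemma lifting_fun_upd:
  assumes "sublinear \<psi>" "feasible_value T \<psi> p v"
  shows "lifting T \<psi> (\<psi>(p := v))"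
  unfolding lifting_def valid_pair_def
proof (intro allI impI ballI, clarify)
  fix k l :: nat and R P :: "nat \<Rightarrow> real ^ 'a" and s :: "nat \<Rightarrow> real" and y :: "nat \<Rightarrow> nat"
  assume sy: "(s, y) \<in> mixed_integer_set T k l R P"
  define z where "z = (\<Sum>i<k. s i *\<^sub>R R i) + (\<Sum>j<l. real (y j) *\<^sub>R P j)"
  have z: "z \<in> T" and s: "\<And>i. i < k \<Longrightarrow> 0 \<le> s i"
    using sy by (auto simp: mixed_integer_set_def z_def)
  define J where "J = {j. j < l \<and> P j = p}"
  define K where "K = {j. j < l \<and> P j \<noteq> p}"
  define N where "N = (\<Sum>j\<in>J. y j)"
  have split: "sum f {..<l} = sum f J + sum f K" for f :: "nat \<Rightarrow> 'b::comm_monoid_add"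
  proof -
    have "{..<l} = J \<union> K" "J \<inter> K = {}" "finite J" "finite K"
      by (auto simp: J_def K_def)
    then show ?thesis by (simp add: sum.union_disjoint)
  qed
  have "(\<Sum>j\<in>J. real (y j) *\<^sub>R P j) = real N *\<^sub>R p"
    by (simp add: J_def N_def scaleR_sum_left)
  then have "z - real N *\<^sub>R p = (\<Sum>i<k. s i *\<^sub>R R i) + (\<Sum>j\<in>K. real (y j) *\<^sub>R P j)"
    by (simp add: z_def split)
  then have "\<psi> (z - real N *\<^sub>R p) \<le> (\<Sum>i<k. \<psi> (s i *\<^sub>R R i)) + (\<Sum>j\<in>K. \<psi> (real (y j) *\<^sub>R P j))"
    by (simp only:) (intro order_trans[OF sublinear_add[OF assms(1)]] add_mono sublinear_sum[OF assms(1)])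
  also have "(\<Sum>i<k. \<psi> (s i *\<^sub>R R i)) = (\<Sum>i<k. \<psi> (R i) * s i)"
    using s by (intro sum.cong) (auto simp: sublinear_scale[OF assms(1)])
  also have "(\<Sum>j\<in>K. \<psi> (real (y j) *\<^sub>R P j)) = (\<Sum>j\<in>K. (\<psi>(p := v)) (P j) * real (y j))"
    by (intro sum.cong) (auto simp: K_def sublinear_scale[OF assms(1)])
  finally have "\<psi> (z - real N *\<^sub>R p) + real N * v
      \<le> (\<Sum>i<k. \<psi> (R i) * s i) + (\<Sum>j\<in>K. (\<psi>(p := v)) (P j) * real (y j)) + real N * v"
    by simp
  moreover have "real N * v = (\<Sum>j\<in>J. (\<psi>(p := v)) (P j) * real (y j))"
    by (simp add: J_def N_def sum_distrib_left mult.commute)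
  ultimately have "\<psi> (z - real N *\<^sub>R p) + real N * v
      \<le> (\<Sum>i<k. \<psi> (R i) * s i) + (\<Sum>j<l. (\<psi>(p := v)) (P j) * real (y j))"
    unfolding split by linarith
  moreover have "1 \<le> \<psi> (z - real N *\<^sub>R p) + real N * v"
    using z assms(2) unfolding feasible_value_def by blast
  ultimately show "1 \<le> (\<Sum>i<k. \<psi> (R i) * s i) + (\<Sum>j<l. (\<psi>(p := v)) (P j) * real (y j))"
    by linarith
qed

text \<open>Each inequality of \<open>valid_pair\<close> involves finitely many columns, and in a
  chain one member is close to the infimum at all of them at once. Nonemptiness of \<open>T\<close>
  bounds the chain below pointwise, so the infimum is genuine.\<close>

lemma lifting_Inf_chain:
  assumes "T \<noteq> {}" "C \<noteq> {}" "\<And>\<pi>. \<pi> \<in> C \<Longrightarrow> lifting T \<psi> \<pi>"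
    and chain: "\<And>\<pi> \<pi>'. \<pi> \<in> C \<Longrightarrow> \<pi>' \<in> C \<Longrightarrow> \<pi> \<le> \<pi>' \<or> \<pi>' \<le> \<pi>"
  shows "lifting T \<psi> (\<lambda>q. INF \<pi>\<in>C. \<pi> q)" and "\<And>\<pi>. \<pi> \<in> C \<Longrightarrow> (\<lambda>q. INF \<pi>\<in>C. \<pi> q) \<le> \<pi>"
proof -
  define \<sigma> where "\<sigma> = (\<lambda>q. INF \<pi>\<in>C. \<pi> q)"
  obtain z where z: "z \<in> T" using assms(1) by blast
  have bdd: "bdd_below ((\<lambda>\<pi>. \<pi> q) ` C)" for q
    using lifting_lower_bound[OF assms(3) z] by (intro bdd_belowI2)
  show "\<And>\<pi>. \<pi> \<in> C \<Longrightarrow> (\<lambda>q. INF \<pi>\<in>C. \<pi> q) \<le> \<pi>"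
    by (intro le_funI cINF_lower[OF bdd])
  \<comment> \<open>Induction on the number of columns: the smaller of the member found so far and
    one that is good at the new column serves both.\<close>
  have approx: "\<exists>\<pi>\<in>C. \<forall>j<l. \<pi> (P j) \<le> \<sigma> (P j) + e" if "e > 0" for l :: nat and P e
  proof (induction l)
    case 0
    then show ?case using assms(2) by blast
  next
    case (Suc l)
    then obtain \<pi> where \<pi>: "\<pi> \<in> C" "\<forall>j<l. \<pi> (P j) \<le> \<sigma> (P j) + e" by blast
    have "(INF \<pi>\<in>C. \<pi> (P l)) < \<sigma> (P l) + e"
      using that by (simp add: \<sigma>_def)
    then obtain \<pi>' where \<pi>': "\<pi>' \<in> C" "\<pi>' (P l) < \<sigma> (P l) + e"
      using cINF_less_iff[OF assms(2) bdd] by blast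
    show ?case
    proof (cases "\<pi> \<le> \<pi>'")
      case True
      then have "\<forall>j<Suc l. \<pi> (P j) \<le> \<sigma> (P j) + e"
        using \<pi> \<pi>' by (metis le_fun_def less_Suc_eq less_imp_le order_trans)
      then show ?thesis using \<pi> by blast
    next
      case False
      then have "\<pi>' \<le> \<pi>" using chain \<pi> \<pi>' by blast
      then have "\<forall>j<Suc l. \<pi>' (P j) \<le> \<sigma> (P j) + e"
        using \<pi> \<pi>' by (metis le_fun_def less_Suc_eq less_imp_le order_trans)
      then show ?thesis using \<pi>' by blast
    qed
  qed
  have "lifting T \<psi> \<sigma>"
    unfolding lifting_def valid_pair_def
  proof (intro allI impI ballI, clarify)
    fix k l :: nat and R P :: "nat \<Rightarrow> real ^ 'a" and s :: "nat \<Rightarrow> real" and y :: "nat \<Rightarrow> nat"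
    assume kl: "\<not> (k = 0 \<and> l = 0)" and sy: "(s, y) \<in> mixed_integer_set T k l R P"
    define Y where "Y = (\<Sum>j<l. real (y j))"
    have Y: "0 \<le> Y" by (simp add: Y_def sum_nonneg)
    have "1 \<le> (\<Sum>i<k. \<psi> (R i) * s i) + (\<Sum>j<l. \<sigma> (P j) * real (y j)) + e" if "e > 0" for e
    proof -
      \<comment> \<open>Errors at the columns add up with total weight \<open>Y\<close>; the summand
        1 covers \<open>Y = 0\<close>.\<close>
      define d where "d = e / (Y + 1)"
      have "d > 0" using that Y by (simp add: d_def)
      then obtain \<pi> where \<pi>: "\<pi> \<in> C" "\<forall>j<l. \<pi> (P j) \<le> \<sigma> (P j) + d" using approx by blast
      have "1 \<le> (\<Sum>i<k. \<psi> (R i) * s i) + (\<Sum>j<l. \<pi> (P j) * real (y j))"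
        using assms(3)[OF \<pi>(1), unfolded lifting_def valid_pair_def, rule_format, OF kl sy] by simp
      moreover have "(\<Sum>j<l. \<pi> (P j) * real (y j)) \<le> (\<Sum>j<l. (\<sigma> (P j) + d) * real (y j))"
        using \<pi>(2) by (intro sum_mono mult_right_mono) auto
      moreover have "(\<Sum>j<l. (\<sigma> (P j) + d) * real (y j)) = (\<Sum>j<l. \<sigma> (P j) * real (y j)) + d * Y"
        by (simp add: Y_def distrib_right sum.distrib sum_distrib_left)
      moreover have "d * Y \<le> e"
        using that Y by (simp add: d_def field_simps)
      ultimately show ?thesis by linarith
    qed
    then show "1 \<le> (\<Sum>i<k. \<psi> (R i) * s i) + (\<Sum>j<l. \<sigma> (P j) * real (y j))"
      by (rule field_le_epsilon)
  qed
  then show "lifting T \<psi> (\<lambda>q. INF \<pi>\<in>C. \<pi> q)" by (simp add: \<sigma>_def)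
qed

text \<open>Zorn's lemma for the reversed pointwise order on the liftings below
  \<open>\<pi>0\<close>: a nonempty chain is bounded by its infimum, the empty one by
  \<open>\<pi>0\<close>.\<close>

lemma minimal_lifting_below:
  assumes "T \<noteq> {}" "lifting T \<psi> \<pi>0"
  obtains \<pi> where "minimal_lifting T \<psi> \<pi>" "\<pi> \<le> \<pi>0"
proof -
  define A where "A = {\<pi>. lifting T \<psi> \<pi> \<and> \<pi> \<le> \<pi>0}"
  have "\<exists>m\<in>A. \<forall>a\<in>A. a \<le> m \<longrightarrow> a = m"
  proof (rule predicate_Zorn)
    show "partial_order_on A (relation_of (\<lambda>x y. y \<le> x) A)"
      by (rule partial_order_on_relation_ofI) auto
    fix C assume "C \<in> Chains (relation_of (\<lambda>x y. y \<le> x) A)"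
    then have C: "C \<subseteq> A" "\<And>x y. x \<in> C \<Longrightarrow> y \<in> C \<Longrightarrow> x \<le> y \<or> y \<le> x"
      by (auto simp: Chains_def relation_of_def)
    show "\<exists>u\<in>A. \<forall>a\<in>C. u \<le> a"
    proof (cases "C = {}")
      case True
      then show ?thesis using assms(2) by (auto simp: A_def)
    next
      case False
      have L: "\<And>\<pi>. \<pi> \<in> C \<Longrightarrow> lifting T \<psi> \<pi>" using C(1) by (auto simp: A_def)
      obtain c where "c \<in> C" using False by blast
      then have "(\<lambda>q. INF \<pi>\<in>C. \<pi> q) \<le> \<pi>0"
        using lifting_Inf_chain(2)[OF assms(1) False L C(2)] C(1) unfolding A_def by fastforce
      then have "(\<lambda>q. INF \<pi>\<in>C. \<pi> q) \<in> A"
        using lifting_Inf_chain(1)[OF assms(1) False L C(2)] by (simp add: A_def)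
      then show ?thesis
        using lifting_Inf_chain(2)[OF assms(1) False L C(2)] by blast
    qed
  qed
  then obtain m where m: "m \<in> A" "\<And>a. a \<in> A \<Longrightarrow> a \<le> m \<Longrightarrow> a = m" by blast
  have "minimal_lifting T \<psi> m"
    unfolding minimal_lifting_def
  proof (intro conjI allI impI)
    show "lifting T \<psi> m" using m(1) by (simp add: A_def)
    fix \<pi> assume "lifting T \<psi> \<pi> \<and> (\<forall>r. \<pi> r \<le> m r)"
    then show "\<pi> = m" using m(1) by (intro m(2)) (auto simp: A_def le_fun_def intro: order_trans)
  qed
  then show thesis using m(1) that by (auto simp: A_def)
qed

text \<open>The feasible values have a least element, attained at \<open>p\<close> by the lifting
  \<open>\<psi>(p := Inf F)\<close>. A minimal lifting below it again has a feasible value at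
  \<open>p\<close>, so it attains the same minimum. This removes liftings from all later
  arguments.\<close>

lemma V_lift_least_feasible:
  assumes "T \<noteq> {}" "sublinear \<psi>" and ge1: "\<And>z. z \<in> T \<Longrightarrow> 1 \<le> \<psi> z"
  shows "feasible_value T \<psi> p (V_lift T \<psi> p)"
    and "\<And>v. feasible_value T \<psi> p v \<Longrightarrow> V_lift T \<psi> p \<le> v"
proof -
  define F where "F = Collect (feasible_value T \<psi> p)"
  obtain z where z: "z \<in> T" using assms(1) by blast
  have "1 \<le> \<psi> (z - real N *\<^sub>R p) + real N * \<psi> p" if "z \<in> T" for z N
    using ge1[OF that] sublinear_add[OF assms(2), of "z - real N *\<^sub>R p" "real N *\<^sub>R p"]
    by (simp add: sublinear_scale[OF assms(2)])
  then have ne: "F \<noteq> {}" by (auto simp: F_def feasible_value_def)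
  have bdd: "bdd_below F"
  proof (rule bdd_belowI)
    fix v assume "v \<in> F"
    then have "1 \<le> \<psi> (z - real 1 *\<^sub>R p) + real 1 * v"
      using z unfolding F_def feasible_value_def by blast
    then show "1 - \<psi> (z - p) \<le> v" by simp
  qed
  have least: "Inf F \<le> v" if "feasible_value T \<psi> p v" for v
    using that bdd by (simp add: F_def cInf_lower)
  \<comment> \<open>For \<open>N = 0\<close> the inequality does not involve the value and is
    \<open>ge1\<close>; for positive \<open>N\<close> it is a lower bound on the value and passes to
    the infimum.\<close>
  have "1 \<le> \<psi> (z - real N *\<^sub>R p) + real N * Inf F" if "z \<in> T" for z N
  proof (cases "N = 0")
    case True
    then show ?thesis using ge1[OF that] by simp
  next
    case False
    have "(1 - \<psi> (z - real N *\<^sub>R p)) / real N \<le> v" if "v \<in> F" for v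
      using that \<open>z \<in> T\<close> False by (force simp: F_def feasible_value_def field_simps)
    then have "(1 - \<psi> (z - real N *\<^sub>R p)) / real N \<le> Inf F"
      using ne by (intro cInf_greatest)
    then show ?thesis using False by (simp add: field_simps)
  qed
  then have feas: "feasible_value T \<psi> p (Inf F)" by (simp add: feasible_value_def)
  obtain \<pi> where \<pi>: "minimal_lifting T \<psi> \<pi>" "\<pi> \<le> \<psi>(p := Inf F)"
    using minimal_lifting_below[OF assms(1) lifting_fun_upd[OF assms(2) feas]] .
  have "\<pi> p \<le> Inf F" using \<pi>(2) by (simp add: le_fun_def) (metis)
  have lower: "Inf F \<le> \<rho> p" if "minimal_lifting T \<psi> \<rho>" for \<rho>
    using that least lifting_feasible_value unfolding minimal_lifting_def by blast
  have "V_lift T \<psi> p = Inf F"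
    unfolding V_lift_def
  proof (rule cInf_eq_minimum)
    show "Inf F \<in> {\<pi> p |\<pi>. minimal_lifting T \<psi> \<pi>}"
      using \<pi>(1) lower[OF \<pi>(1)] \<open>\<pi> p \<le> Inf F\<close> by force
  qed (use lower in auto)
  then show "feasible_value T \<psi> p (V_lift T \<psi> p)"
    and "\<And>v. feasible_value T \<psi> p v \<Longrightarrow> V_lift T \<psi> p \<le> v"
    using feas least by auto
qed

subsection \<open>Representations of free polyhedra\<close>

lemma facet_of_translation_eq: "(+) a ` F facet_of (+) a ` S \<longleftrightarrow> F facet_of S"
  by (simp add: facet_of_def aff_dim_translation_eq)

lemma polyhedron_translation:
  assumes "polyhedron S"
  shows "polyhedron ((+) t ` S)"
proof -
  obtain F where F: "finite F" "S = \<Inter>F" "\<And>h. h \<in> F \<Longrightarrow> \<exists>a b. a \<noteq> 0 \<and> h = {x. a \<bullet> x \<le> b}"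
    using assms unfolding polyhedron_def by metis
  have "(+) t ` {x. a \<bullet> x \<le> b} = {x. a \<bullet> x \<le> b + a \<bullet> t}" for a b
  proof (intro equalityI subsetI)
    fix x assume "x \<in> {x. a \<bullet> x \<le> b + a \<bullet> t}"
    then have "x = t + (x - t)" "x - t \<in> {x. a \<bullet> x \<le> b}" by (simp_all add: inner_diff_right)
    then show "x \<in> (+) t ` {x. a \<bullet> x \<le> b}" by blast
  qed (auto simp: inner_add_right)
  then have "\<And>h. h \<in> F \<Longrightarrow> \<exists>a b. a \<noteq> 0 \<and> (+) t ` h = {x. a \<bullet> x \<le> b}"
    using F(3) by metis
  moreover have "(+) t ` S = \<Inter> ((`) ((+) t) ` F)"
    using bij_image_INT[of "(+) t" id F] by (simp add: F(2))
  ultimately show ?thesis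
    unfolding polyhedron_def using F(1) by (intro exI[of _ "(`) ((+) t) ` F"]) auto
qed

section \<open>Facet normals under translation\<close>

lemma facet_normal_less:
  assumes "a \<in> facet_normals C" "x \<in> interior C"
  shows "a \<bullet> x < 1"
proof -
  have "a \<noteq> 0"
    using assms(1) by (auto simp: facet_normals_def facet_of_def)
  have "C \<subseteq> {x. a \<bullet> x \<le> 1}" using assms(1) by (auto simp: facet_normals_def)
  then have "interior C \<subseteq> {x. a \<bullet> x < 1}"
    using interior_mono interior_halfspace_le[OF \<open>a \<noteq> 0\<close>] by metis
  then show ?thesis using assms(2) by blast
qed

lemma interior_translated_iff:
  fixes t :: "'a::real_normed_vector"
  shows "0 \<in> interior ((+) t ` C) \<longleftrightarrow> - t \<in> interior C"
proof -
  have "0 \<in> (+) t ` interior C \<longleftrightarrow> - t \<in> interior C"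
    by (force simp: image_iff add_eq_0_iff)
  then show ?thesis by (simp add: interior_translation)
qed

text \<open>The inequality \<open>a \<bullet> (r - t) \<le> 1\<close> of the translated set, divided
  by \<open>1 + a \<bullet> t\<close> to make the right-hand side 1 again.\<close>

definition shift_normal :: "real ^ 'n \<Rightarrow> real ^ 'n \<Rightarrow> real ^ 'n" where
  "shift_normal t a = (1 / (1 + a \<bullet> t)) *\<^sub>R a"

lemma shift_normal_in:
  assumes a: "a \<in> facet_normals C" and "0 \<in> interior ((+) t ` C)"
  shows "shift_normal t a \<in> facet_normals ((+) t ` C)"
proof -
  \<comment> \<open>The second assumption says that \<open>- t\<close> is interior to
    \<open>C\<close>, where facet inequalities are strict.\<close>
  have pos: "0 < 1 + a \<bullet> t"
    using facet_normal_less[OF a, of "- t"] assms(2) by (simp add: interior_translated_iff)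
  have eq: "shift_normal t a \<bullet> (t + r) = (a \<bullet> t + a \<bullet> r) / (1 + a \<bullet> t)" for r
    by (simp add: shift_normal_def inner_add_right add_divide_distrib)
  have le: "shift_normal t a \<bullet> (t + r) \<le> 1 \<longleftrightarrow> a \<bullet> r \<le> 1" for r
    using pos by (simp add: eq)
  have one: "shift_normal t a \<bullet> (t + r) = 1 \<longleftrightarrow> a \<bullet> r = 1" for r
    using pos by (simp add: eq)
  have "{r \<in> (+) t ` C. shift_normal t a \<bullet> r = 1} = (+) t ` {r \<in> C. a \<bullet> r = 1}"
    using one by auto
  then show ?thesis
    using a le by (simp add: facet_normals_def facet_of_translation_eq)
qed

text \<open>Only surjectivity is left: a normal of the translated set is carried back by
  \<open>shift_normal (- t)\<close>, which \<open>shift_normal t\<close> inverts.\<close>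

lemma facet_normals_translate:
  assumes "0 \<in> interior C" "0 \<in> interior ((+) t ` C)"
  shows "facet_normals ((+) t ` C) = shift_normal t ` facet_normals C"
proof (intro equalityI subsetI)
  fix a assume a: "a \<in> facet_normals ((+) t ` C)"
  have id: "(+) (- t) ` (+) t ` C = C" by (simp add: image_image)
  have pos: "0 < 1 - a \<bullet> t"
    using facet_normal_less[OF a, of t] assms(1) by (simp add: interior_translation image_iff)
  have "shift_normal (- t) a \<in> facet_normals C"
    using shift_normal_in[OF a, of "- t"] assms(1) unfolding id by blast
  moreover have "shift_normal t (shift_normal (- t) a) = a"
    using pos by (simp add: shift_normal_def field_simps)
  ultimately show "a \<in> shift_normal t ` facet_normals C" by (metis imageI)
qed (use shift_normal_in assms in auto)

text \<open>Nonemptiness of \<open>T\<close> excludes \<open>C = UNIV\<close>, so that the maximum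
  defining \<open>smallest_rep\<close> is over a nonempty set.\<close>

locale free_polyhedron =
  fixes T C :: "(real ^ 'n) set"
  assumes poly: "polyhedron C" and zero: "0 \<in> interior C"
    and free: "T \<inter> interior C = {}" and nonempty: "T \<noteq> {}"
begin

abbreviation "\<psi> \<equiv> smallest_rep C"
abbreviation "V \<equiv> V_lift T \<psi>"

lemma finite_normals: "finite (facet_normals C)"
  using facet_normals_rep(1)[OF poly zero] .

lemma normals_nonempty: "facet_normals C \<noteq> {}"
proof
  assume "facet_normals C = {}"
  then have "C = UNIV" using facet_normals_rep(2)[OF poly zero] by simp
  then show False using free nonempty by simp
qed

lemma rep_le_iff: "\<psi> r \<le> h \<longleftrightarrow> (\<forall>a\<in>facet_normals C. a \<bullet> r \<le> h)"
  using finite_normals normals_nonempty by (simp add: smallest_rep_def)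

lemma rep_less_iff: "\<psi> r < h \<longleftrightarrow> (\<forall>a\<in>facet_normals C. a \<bullet> r < h)"
  using finite_normals normals_nonempty by (simp add: smallest_rep_def)

lemma inner_le_rep: "a \<in> facet_normals C \<Longrightarrow> a \<bullet> r \<le> \<psi> r"
  using rep_le_iff by blast

lemma rep_attained: obtains a where "a \<in> facet_normals C" "\<psi> r = a \<bullet> r"
  using rep_less_iff[of r "\<psi> r"] inner_le_rep by (metis order.irrefl order_le_less)

lemma sublinear_rep: "sublinear \<psi>"
  unfolding sublinear_def
proof (intro conjI allI impI)
  fix x y c
  show "\<psi> (x + y) \<le> \<psi> x + \<psi> y"
    unfolding rep_le_iff by (simp add: inner_add_right add_mono inner_le_rep)
  show "\<psi> (c *\<^sub>R x) = c * \<psi> x" if "0 \<le> c" for c :: real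
  proof (rule antisym)
    show "\<psi> (c *\<^sub>R x) \<le> c * \<psi> x"
      unfolding rep_le_iff by (simp add: mult_left_mono inner_le_rep that)
    obtain a where a: "a \<in> facet_normals C" "\<psi> x = a \<bullet> x" by (rule rep_attained)
    then show "c * \<psi> x \<le> \<psi> (c *\<^sub>R x)"
      using inner_le_rep[OF a(1), of "c *\<^sub>R x"] by simp
  qed
qed

lemmas rep_add = sublinear_add[OF sublinear_rep]
  and rep_scale = sublinear_scale[OF sublinear_rep]

lemma rep_less_1: "x \<in> interior C \<Longrightarrow> \<psi> x < 1"
  by (simp add: rep_less_iff facet_normal_less)

text \<open>The points satisfying all facet inequalities strictly form an open subset of
  \<open>C\<close>, hence lie in its interior, which misses \<open>T\<close>.\<close>

lemma rep_ge_1: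
  assumes "z \<in> T" shows "1 \<le> \<psi> z"
proof (rule ccontr)
  assume "\<not> 1 \<le> \<psi> z"
  then have z: "z \<in> (\<Inter>a\<in>facet_normals C. {r. a \<bullet> r < 1})"
    by (auto simp: not_le rep_less_iff)
  have "open (\<Inter>a\<in>facet_normals C. {r. a \<bullet> r < 1})"
    using finite_normals by (intro open_INT) (auto simp: open_halfspace_lt)
  moreover have "(\<Inter>a\<in>facet_normals C. {r. a \<bullet> r < 1}) \<subseteq> C"
    by (subst (2) facet_normals_rep(2)[OF poly zero]) (auto intro: less_imp_le)
  ultimately have "z \<in> interior C" using z interiorI by blast
  then show False using assms free by blast
qed

lemma V_least: "feasible_value T \<psi> p v \<Longrightarrow> V p \<le> v"
  using V_lift_least_feasible(2) nonempty sublinear_rep rep_ge_1 by blast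

lemma V_ge: "z \<in> T \<Longrightarrow> 1 \<le> \<psi> (z - real N *\<^sub>R p) + real N * V p"
  using V_lift_least_feasible(1) nonempty sublinear_rep rep_ge_1
  unfolding feasible_value_def by blast

text \<open>The spindle conditions say that a normal maximal at \<open>x\<close> is also maximal at
  \<open>r\<close> and at \<open>x - r\<close>, which is equality in subadditivity. This form
  mentions no normals and is the one carried through the translation.\<close>

lemma spindle_iff: "r \<in> spindle C x \<longleftrightarrow> \<psi> r + \<psi> (x - r) = \<psi> x"
proof -
  obtain d where d: "d \<in> facet_normals C" "\<psi> x = d \<bullet> x" by (rule rep_attained)
  have "r \<in> spindle C x \<longleftrightarrow> \<psi> r \<le> d \<bullet> r \<and> \<psi> (x - r) \<le> d \<bullet> (x - r)"
    unfolding spindle_eq[OF d] rep_le_iff by (auto simp: inner_diff_left)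
  moreover have "d \<bullet> r + d \<bullet> (x - r) = \<psi> x" by (simp add: d(2) inner_diff_right)
  ultimately show ?thesis
    using inner_le_rep[OF d(1), of r] inner_le_rep[OF d(1), of "x - r"] by linarith
qed

lemma Delta_iff: "(x, real m) \<in> Delta T C p \<longleftrightarrow> \<psi> (x - real m *\<^sub>R p) \<le> 1 - real m * V p"
  unfolding rep_le_iff by (simp add: Delta_def Let_def inner_diff_right algebra_simps)

lemma covering_region_iff:
  "u \<in> covering_region T C p \<longleftrightarrow>
     (\<exists>x\<in>T. \<exists>m i r. i \<le> m \<and> \<psi> (x - real m *\<^sub>R p) \<le> 1 - real m * V p \<and>
        \<psi> r + \<psi> (x - real m *\<^sub>R p - r) = \<psi> (x - real m *\<^sub>R p) \<and> u = r + real i *\<^sub>R p)"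
  by (force simp: covering_region_def Delta_iff spindle_iff image_iff)

end

subsection \<open>Translations\<close>

locale translated_free_polyhedron = free_polyhedron T C for T C :: "(real ^ 'n) set" +
  fixes t :: "real ^ 'n"
  assumes zero': "0 \<in> interior ((+) t ` C)"

sublocale translated_free_polyhedron \<subseteq> tr: free_polyhedron "(+) t ` T" "(+) t ` C"
proof
  show "polyhedron ((+) t ` C)" using poly by (simp add: polyhedron_translation)
  have "(+) t ` T \<inter> (+) t ` interior C = (+) t ` (T \<inter> interior C)" by auto
  then show "(+) t ` T \<inter> interior ((+) t ` C) = {}" using free by (simp add: interior_translation)
qed (use zero' nonempty in auto)

context translated_free_polyhedron
begin

section \<open>Levels of the representation and lifting values under translation\<close>

lemma shift_pos: "a \<in> facet_normals C \<Longrightarrow> 0 < 1 + a \<bullet> t"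
  using facet_normal_less[of a C "- t"] zero' by (simp add: interior_translated_iff)

text \<open>The excess over the level \<open>h\<close> is only multiplied by the positive factor
  \<open>1 / (1 + a \<bullet> t)\<close>. Hence comparisons with \<open>h\<close> survive the move
  from \<open>q\<close> to \<open>q + h *\<^sub>R t\<close>; for positive \<open>h\<close> this
  reflects that \<open>h (C + t) = h C + h t\<close>.\<close>

lemma shift_normal_inner:
  "a \<in> facet_normals C \<Longrightarrow> shift_normal t a \<bullet> (q + h *\<^sub>R t) = h + (a \<bullet> q - h) / (1 + a \<bullet> t)"
  using shift_pos[of a] by (simp add: shift_normal_def inner_add_right divide_simps) (simp add: algebra_simps)

lemma shift_normal_inner_iff:
  assumes "a \<in> facet_normals C"
  shows "shift_normal t a \<bullet> (q + h *\<^sub>R t) \<le> h \<longleftrightarrow> a \<bullet> q \<le> h"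
    and "shift_normal t a \<bullet> (q + h *\<^sub>R t) < h \<longleftrightarrow> a \<bullet> q < h"
  using shift_pos[OF assms]
  by (auto simp: shift_normal_inner[OF assms] divide_le_0_iff divide_less_0_iff)

lemma tr_rep_le_iff: "tr.\<psi> (q + h *\<^sub>R t) \<le> h \<longleftrightarrow> \<psi> q \<le> h"
  by (simp add: tr.rep_le_iff rep_le_iff facet_normals_translate[OF zero zero'] shift_normal_inner_iff)

lemma tr_rep_less_iff: "tr.\<psi> (q + h *\<^sub>R t) < h \<longleftrightarrow> \<psi> q < h"
  by (simp add: tr.rep_less_iff rep_less_iff facet_normals_translate[OF zero zero'] shift_normal_inner_iff)

lemma tr_rep_eq: "tr.\<psi> (q + \<psi> q *\<^sub>R t) = \<psi> q"
  using tr_rep_le_iff[of q "\<psi> q"] tr_rep_less_iff[of q "\<psi> q"] by simp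

lemma tr_arg: "(t + z) - real N *\<^sub>R (p + v *\<^sub>R t) = (z - real N *\<^sub>R p) + (1 - real N * v) *\<^sub>R t"
  by (simp add: algebra_simps)

lemma tr_V: "tr.V (p + V p *\<^sub>R t) = V p"
proof (rule antisym)
  \<comment> \<open>By \<open>tr_arg\<close> the translated constraint compares at the level
    \<open>h = 1 - N V\<close>, for which \<open>tr_rep_less_iff\<close> is made.\<close>
  have "1 - real N * V p \<le> tr.\<psi> (z - real N *\<^sub>R p + (1 - real N * V p) *\<^sub>R t)" if "z \<in> T" for z N
    using V_ge[OF that, of N p] tr_rep_less_iff[of "z - real N *\<^sub>R p" "1 - real N * V p"] by linarith
  then have "feasible_value ((+) t ` T) tr.\<psi> (p + V p *\<^sub>R t) (V p)"
    by (auto simp: feasible_value_def tr_arg) (smt (verit))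
  then show "tr.V (p + V p *\<^sub>R t) \<le> V p" by (rule tr.V_least)
  show "V p \<le> tr.V (p + V p *\<^sub>R t)"
  proof (rule ccontr)
    define v' where "v' = tr.V (p + V p *\<^sub>R t)"
    define \<delta> where "\<delta> = V p - v'"
    \<comment> \<open>This is the minimum of \<open>1 + a \<bullet> t\<close> over the facet
      normals. A violation by less than \<open>N \<mu> \<delta>\<close> before translation stays
      below \<open>N \<delta>\<close> after the rescaling by \<open>1 / (1 + a \<bullet> t)\<close>,
      contradicting feasibility of \<open>v'\<close>.\<close>
    define \<mu> where "\<mu> = 1 - \<psi> (- t)"
    assume "\<not> V p \<le> tr.V (p + V p *\<^sub>R t)"
    then have \<delta>: "0 < \<delta>" by (simp add: \<delta>_def v'_def)
    have "0 < \<mu>"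
      using rep_less_1[of "- t"] zero' by (simp add: \<mu>_def interior_translated_iff)
    have \<mu>: "\<mu> \<le> 1 + a \<bullet> t" if "a \<in> facet_normals C" for a
      using inner_le_rep[OF that, of "- t"] by (simp add: \<mu>_def)
    have "\<not> feasible_value T \<psi> p (V p - \<mu> * \<delta>)"
      using V_least[of p "V p - \<mu> * \<delta>"] mult_pos_pos[OF \<open>0 < \<mu>\<close> \<delta>] by linarith
    then obtain z N where z: "z \<in> T"
      and less: "\<psi> (z - real N *\<^sub>R p) < 1 - real N * (V p - \<mu> * \<delta>)"
      by (auto simp: feasible_value_def not_le) (smt (verit))
    define q where "q = z - real N *\<^sub>R p"
    define h where "h = 1 - real N * V p"
    have "1 - real N * v' \<le> tr.\<psi> (q + h *\<^sub>R t)"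
      using tr.V_ge[of "t + z" N "p + V p *\<^sub>R t"] z by (simp add: v'_def tr_arg q_def h_def)
    moreover obtain a where a: "a \<in> facet_normals C"
      and "tr.\<psi> (q + h *\<^sub>R t) = shift_normal t a \<bullet> (q + h *\<^sub>R t)"
      using tr.rep_attained[of "q + h *\<^sub>R t"] unfolding facet_normals_translate[OF zero zero'] by blast
    ultimately have ge: "1 - real N * v' \<le> shift_normal t a \<bullet> (q + h *\<^sub>R t)" by simp
    have "real N * \<delta> \<le> (a \<bullet> q - h) / (1 + a \<bullet> t)"
    proof -
      have "1 - real N * v' = h + real N * \<delta>" by (simp add: \<delta>_def h_def algebra_simps)
      then show ?thesis using ge unfolding shift_normal_inner[OF a] by linarith
    qed
    then have "real N * \<delta> * (1 + a \<bullet> t) \<le> a \<bullet> q - h"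
      using shift_pos[OF a] by (simp add: pos_le_divide_eq)
    moreover have "real N * \<delta> * \<mu> \<le> real N * \<delta> * (1 + a \<bullet> t)"
      using \<mu>[OF a] \<delta> by (intro mult_left_mono) auto
    moreover have "a \<bullet> q < h + real N * \<delta> * \<mu>"
      using less inner_le_rep[OF a, of q] by (simp add: q_def h_def algebra_simps)
    ultimately show False by linarith
  qed
qed

text \<open>The witnesses are \<open>t + x\<close>, the same \<open>m\<close> and \<open>i\<close>,
  and \<open>r + \<psi> r *\<^sub>R t\<close>. By \<open>tr_rep_eq\<close> the values at
  \<open>r\<close>, at the remainder and at their sum are unchanged, so additivity on the spindle is
  preserved.\<close>

lemma tr_covering_region:
  assumes x: "x \<in> T" "i \<le> m" "\<psi> (x - real m *\<^sub>R p) \<le> 1 - real m * V p"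
    and r: "\<psi> r + \<psi> (x - real m *\<^sub>R p - r) = \<psi> (x - real m *\<^sub>R p)"
  shows "r + real i *\<^sub>R p + (\<psi> r + real i * V p) *\<^sub>R t
           \<in> covering_region ((+) t ` T) ((+) t ` C) (p + V p *\<^sub>R t)"
proof -
  define q where "q = x - real m *\<^sub>R p"
  \<comment> \<open>Membership in \<open>Delta\<close> gives one inequality, feasibility of
    \<open>V p\<close> the other.\<close>
  have q: "\<psi> q = 1 - real m * V p"
    using x(3) V_ge[OF x(1), of m p] by (simp add: q_def)
  have q': "(t + x) - real m *\<^sub>R (p + V p *\<^sub>R t) = q + \<psi> q *\<^sub>R t"
    by (simp only: tr_arg q) (simp add: q_def)
  have diff: "q + \<psi> q *\<^sub>R t - (r + \<psi> r *\<^sub>R t) = (q - r) + \<psi> (q - r) *\<^sub>R t"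
    unfolding r[folded q_def, symmetric] by (simp add: algebra_simps)
  show ?thesis
    unfolding tr.covering_region_iff
  proof (intro bexI exI conjI)
    show "tr.\<psi> (r + \<psi> r *\<^sub>R t) + tr.\<psi> ((t + x) - real m *\<^sub>R (p + V p *\<^sub>R t) - (r + \<psi> r *\<^sub>R t))
            = tr.\<psi> ((t + x) - real m *\<^sub>R (p + V p *\<^sub>R t))"
      unfolding q' diff tr_rep_eq using r by (simp add: q_def)
    show "tr.\<psi> ((t + x) - real m *\<^sub>R (p + V p *\<^sub>R t)) \<le> 1 - real m * tr.V (p + V p *\<^sub>R t)"
      unfolding q' tr_rep_eq tr_V by (simp add: q)
  qed (use x in \<open>auto simp: algebra_simps\<close>)
qed

end

subsection \<open>The induced extension of the representation\<close>

lemma W_set_uminus: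
  assumes "w \<in> W_set T"
  shows "- w \<in> W_set T"
proof -
  have "s + of_int (- k) *\<^sub>R w \<in> T" if "s \<in> T" for s k
    using assms that unfolding W_set_def by blast
  then show ?thesis by (simp add: W_set_def)
qed

lemma W_set_zero: "0 \<in> W_set T"
  by (simp add: W_set_def)

lemma W_setD:
  assumes "w \<in> W_set T" "s \<in> T"
  shows "s + w \<in> T"
proof -
  have "s + of_int 1 *\<^sub>R w \<in> T" using assms unfolding W_set_def by blast
  then show ?thesis by simp
qed

lemma W_set_translation: "W_set ((+) t ` T) = W_set T"
  by (auto simp: W_set_def image_iff add.assoc)

context free_polyhedron
begin

text \<open>The function \<open>\<pi>\<close> of the overview; \<open>extension_bdd\<close> and
  \<open>W_set_zero\<close> make the infimum genuine.\<close>

definition extension_value :: "real ^ 'n \<Rightarrow> real ^ 'n \<Rightarrow> real" where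
  "extension_value p u = (INF (i, w)\<in>UNIV \<times> W_set T. \<psi> (u + w - real i *\<^sub>R p) + real i * V p)"

text \<open>A candidate for \<open>u\<close> with \<open>i\<close> copies of \<open>p\<close> and
  one for \<open>x - u\<close> with \<open>j\<close> copies combine to reach \<open>x + w\<close>, a
  point of \<open>T\<close>, with \<open>i + j\<close> copies; \<open>V_ge\<close> bounds the total
  cost below by 1.\<close>

lemma extension_candidate_ge:
  assumes "x \<in> T" "w \<in> W_set T"
  shows "1 - (\<psi> (x - u - real j *\<^sub>R p) + real j * V p) \<le> \<psi> (u + w - real i *\<^sub>R p) + real i * V p"
proof -
  have "x + w \<in> T" using assms W_setD by blast
  then have "1 \<le> \<psi> (x + w - real (i + j) *\<^sub>R p) + real (i + j) * V p" by (rule V_ge)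
  moreover have "\<psi> (x + w - real (i + j) *\<^sub>R p)
      \<le> \<psi> (u + w - real i *\<^sub>R p) + \<psi> (x - u - real j *\<^sub>R p)"
    using rep_add[of "u + w - real i *\<^sub>R p" "x - u - real j *\<^sub>R p"] by (simp add: algebra_simps)
  ultimately show ?thesis by (simp add: algebra_simps)
qed

lemma extension_bdd:
  "bdd_below ((\<lambda>(i, w). \<psi> (u + w - real i *\<^sub>R p) + real i * V p) ` (UNIV \<times> W_set T))"
proof -
  obtain x where "x \<in> T" using nonempty by blast
  then show ?thesis
    using extension_candidate_ge[of x _ u 0 p] by (intro bdd_belowI2[of _ "1 - \<psi> (x - u)"]) auto
qed

lemma extension_value_le:
  "w \<in> W_set T \<Longrightarrow> extension_value p u \<le> \<psi> (u + w - real i *\<^sub>R p) + real i * V p"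
  unfolding extension_value_def using cINF_lower[OF extension_bdd, of "(i, w)"] by force

lemma extension_value_ge:
  assumes "\<And>i w. w \<in> W_set T \<Longrightarrow> c \<le> \<psi> (u + w - real i *\<^sub>R p) + real i * V p"
  shows "c \<le> extension_value p u"
  unfolding extension_value_def using assms W_set_zero by (intro cINF_greatest) auto

lemma extension_value_le_rep: "extension_value p u \<le> \<psi> u"
  using extension_value_le[OF W_set_zero, of p u 0] by simp

lemma extension_value_ge_rep: "x \<in> T \<Longrightarrow> 1 - \<psi> (x - u) \<le> extension_value p u"
  using extension_candidate_ge[of x _ u 0 p] by (intro extension_value_ge) auto

lemma extension_value_add: "extension_value p (u + v) \<le> extension_value p u + \<psi> v"
proof -
  have "extension_value p (u + v) - \<psi> v \<le> extension_value p u"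
  proof (rule extension_value_ge)
    fix i w assume "w \<in> W_set T"
    then have "extension_value p (u + v) \<le> \<psi> (u + v + w - real i *\<^sub>R p) + real i * V p"
      by (rule extension_value_le)
    moreover have "\<psi> (u + v + w - real i *\<^sub>R p) \<le> \<psi> (u + w - real i *\<^sub>R p) + \<psi> v"
      using rep_add[of "u + w - real i *\<^sub>R p" v] by (simp add: algebra_simps)
    ultimately show "extension_value p (u + v) - \<psi> v \<le> \<psi> (u + w - real i *\<^sub>R p) + real i * V p"
      by linarith
  qed
  then show ?thesis by linarith
qed

text \<open>The candidate \<open>(i, - w)\<close> gives the upper bound. Completing any candidate by
  \<open>x - real m *\<^sub>R p - r\<close> and the remaining \<open>m - i\<close> copies of
  \<open>p\<close> reaches \<open>x + w\<close>; this completion costs at most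
  \<open>1 - \<psi> r - i V\<close>, so no candidate is cheaper.\<close>

lemma extension_value_covered:
  assumes x: "x \<in> T" "i \<le> m" "\<psi> (x - real m *\<^sub>R p) \<le> 1 - real m * V p"
    and r: "\<psi> r + \<psi> (x - real m *\<^sub>R p - r) = \<psi> (x - real m *\<^sub>R p)"
    and w: "w \<in> W_set T"
  shows "extension_value p (r + real i *\<^sub>R p + w) = \<psi> r + real i * V p"
proof (rule antisym)
  show "extension_value p (r + real i *\<^sub>R p + w) \<le> \<psi> r + real i * V p"
    using extension_value_le[OF W_set_uminus[OF w], of p "r + real i *\<^sub>R p + w" i] by simp
  show "\<psi> r + real i * V p \<le> extension_value p (r + real i *\<^sub>R p + w)"
  proof (rule extension_value_ge)
    fix i' w' assume w': "w' \<in> W_set T"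
    have "x + w - (r + real i *\<^sub>R p + w) - real (m - i) *\<^sub>R p = x - real m *\<^sub>R p - r"
      using x(2) by (simp add: of_nat_diff algebra_simps)
    then have "1 - (\<psi> (x - real m *\<^sub>R p - r) + real (m - i) * V p)
        \<le> \<psi> (r + real i *\<^sub>R p + w + w' - real i' *\<^sub>R p) + real i' * V p"
      using extension_candidate_ge[OF W_setD[OF w x(1)] w', of "r + real i *\<^sub>R p + w" "m - i" p i']
      by (simp only:)
    moreover have "real (m - i) * V p = real m * V p - real i * V p"
      using x(2) by (simp add: of_nat_diff algebra_simps)
    ultimately show "\<psi> r + real i * V p
        \<le> \<psi> (r + real i *\<^sub>R p + w + w' - real i' *\<^sub>R p) + real i' * V p"
      using x(3) r by linarith
  qed
qed

lemma extension_value_line_continuous: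
  "continuous_on UNIV (\<lambda>s. extension_value p (u + s *\<^sub>R t))"
proof -
  \<comment> \<open>\<open>\<psi>\<close> is linear on each of the two rays of the line; the
    absolute values make \<open>L\<close> nonnegative.\<close>
  define L where "L = max \<bar>\<psi> t\<bar> \<bar>\<psi> (- t)\<bar>"
  have L: "\<psi> (c *\<^sub>R t) \<le> L * \<bar>c\<bar>" for c
  proof (cases "0 \<le> c")
    case True
    then show ?thesis
      using mult_right_mono[of "\<psi> t" L c] by (simp add: rep_scale L_def mult.commute)
  next
    case False
    then show ?thesis
      using mult_right_mono[of "\<psi> (- t)" L "- c"] rep_scale[of "- c" "- t"]
      by (simp add: L_def mult.commute)
  qed
  have step: "extension_value p (u + x *\<^sub>R t) - extension_value p (u + y *\<^sub>R t) \<le> L * \<bar>x - y\<bar>" for x y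
    using extension_value_add[of p "u + y *\<^sub>R t" "(x - y) *\<^sub>R t"] L[of "x - y"]
    by (simp add: algebra_simps)
  have "L-lipschitz_on UNIV (\<lambda>s. extension_value p (u + s *\<^sub>R t))"
  proof (rule lipschitz_onI)
    fix x y
    show "dist (extension_value p (u + x *\<^sub>R t)) (extension_value p (u + y *\<^sub>R t)) \<le> L * dist x y"
      using step[of x y] step[of y x] by (simp add: dist_real_def abs_le_iff abs_minus_commute)
  qed (simp add: L_def)
  then show ?thesis by (rule lipschitz_on_continuous_on)
qed

end

section \<open>Surjectivity of the map and transfer of the covering\<close>

context translated_free_polyhedron
begin

text \<open>The preimage is sought on the line through \<open>u'\<close> parallel to
  \<open>t\<close>: a zero \<open>l\<close> of \<open>g\<close> gives
  \<open>u = u' + l *\<^sub>R t\<close>, and the intermediate value theorem supplies one.\<close>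

lemma extension_map_surj: obtains u where "u' = u + extension_value p u *\<^sub>R t"
proof -
  define g where "g = (\<lambda>s. s + extension_value p (u' + s *\<^sub>R t))"
  define \<mu> where "\<mu> = 1 - \<psi> (- t)"
  have \<mu>: "0 < \<mu>"
    using rep_less_1[of "- t"] zero' by (simp add: \<mu>_def interior_translated_iff)
  obtain x where x: "x \<in> T" using nonempty by blast
  \<comment> \<open>The bounds on \<open>g\<close> at \<open>- c\<close> and \<open>c\<close> are
    the constants \<open>\<psi> u'\<close> and \<open>1 - \<psi> (x - u')\<close>, shifted by
    \<open>c * \<mu>\<close> downwards and upwards; \<open>c\<close> is large enough to fix both
    signs.\<close>
  define c where "c = max \<bar>\<psi> u'\<bar> \<bar>1 - \<psi> (x - u')\<bar> / \<mu>"
  have c: "0 \<le> c" "\<psi> u' \<le> c * \<mu>" "- (1 - \<psi> (x - u')) \<le> c * \<mu>"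
    using \<mu> by (auto simp: c_def)
  have scale: "\<psi> (- (c *\<^sub>R t)) = c * \<psi> (- t)"
    using rep_scale[OF c(1), of "- t"] by simp
  have "extension_value p (u' + (- c) *\<^sub>R t) \<le> \<psi> u' + c * \<psi> (- t)"
    using extension_value_le_rep[of p "u' + (- c) *\<^sub>R t"] rep_add[of u' "- (c *\<^sub>R t)"] scale by simp
  then have lo: "g (- c) \<le> 0"
    using c(2) by (simp add: g_def \<mu>_def algebra_simps)
  have "1 - (\<psi> (x - u') + c * \<psi> (- t)) \<le> extension_value p (u' + c *\<^sub>R t)"
    using extension_value_ge_rep[OF x, of "u' + c *\<^sub>R t" p] rep_add[of "x - u'" "- (c *\<^sub>R t)"] scale
    by (simp add: algebra_simps)
  then have hi: "0 \<le> g c"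
    using c(3) by (simp add: g_def \<mu>_def algebra_simps)
  have "continuous_on {- c..c} g"
    unfolding g_def
    by (intro continuous_intros continuous_on_subset[OF extension_value_line_continuous]) auto
  then obtain l where "g l = 0"
    using IVT'[of g "- c" 0 c] lo hi c(1) by auto
  then have "u' = (u' + l *\<^sub>R t) + extension_value p (u' + l *\<^sub>R t) *\<^sub>R t"
    by (simp add: g_def add.assoc flip: scaleR_add_left)
  then show thesis by (rule that)
qed

text \<open>If \<open>u = y + w\<close> is the covering of a preimage of \<open>u'\<close>, then
  \<open>u' - w\<close> is exactly the point produced by \<open>tr_covering_region\<close>, because
  \<open>extension_value_covered\<close> identifies the coefficient of \<open>t\<close>.\<close>

lemma tr_covering:
  assumes "{x + w | x w. x \<in> covering_region T C p \<and> w \<in> W_set T} = UNIV"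
  shows "{x + w | x w. x \<in> covering_region ((+) t ` T) ((+) t ` C) (p + V p *\<^sub>R t) \<and>
           w \<in> W_set ((+) t ` T)} = UNIV"
proof -
  have "\<exists>y w. u' = y + w \<and> y \<in> covering_region ((+) t ` T) ((+) t ` C) (p + V p *\<^sub>R t) \<and>
          w \<in> W_set T" for u'
  proof -
    obtain u where u: "u' = u + extension_value p u *\<^sub>R t" by (rule extension_map_surj)
    obtain y w where yw: "u = y + w" "y \<in> covering_region T C p" "w \<in> W_set T"
      using assms by blast
    then obtain x m i r where x: "x \<in> T" "i \<le> m" "\<psi> (x - real m *\<^sub>R p) \<le> 1 - real m * V p"
      "\<psi> r + \<psi> (x - real m *\<^sub>R p - r) = \<psi> (x - real m *\<^sub>R p)" and y: "y = r + real i *\<^sub>R p"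
      unfolding covering_region_iff by blast
    have "extension_value p u = \<psi> r + real i * V p"
      using extension_value_covered[OF x yw(3)] by (simp add: yw(1) y)
    then have "u' = (r + real i *\<^sub>R p + (\<psi> r + real i * V p) *\<^sub>R t) + w"
      by (simp add: u yw(1) y)
    then show ?thesis using tr_covering_region[OF x] yw(3) by blast
  qed
  then show ?thesis by (auto simp: W_set_translation)
qed

end

theorem theorem3p11:
  fixes b t p p' :: "real ^ 'n" and Q S B :: "(real ^ 'n) set" and \<psi> :: "real ^ 'n \<Rightarrow> real"
  assumes "b \<notin> integer_vectors"
    and "rational_polyhedron Q"
    and "S = {b + z | z. z \<in> integer_vectors} \<inter> Q"
    and "maximal_free_convex_nbhd S B"
    and "polyhedron B"
    and "\<psi> = smallest_rep B"
    and "0 \<in> interior ((+) t ` B)"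
    and "p' = p + V_lift S \<psi> p *\<^sub>R t"
  shows "{x + w | x w. x \<in> covering_region S B p \<and> w \<in> W_set S} = UNIV \<longleftrightarrow>
         {x + w | x w. x \<in> covering_region ((+) t ` S) ((+) t ` B) p' \<and> w \<in> W_set ((+) t ` S)} = UNIV"
proof (cases "S = {}")
  case True
  \<comment> \<open>Both covering regions are empty, so both sides are false.\<close>
  then show ?thesis by (simp add: covering_region_def)
next
  case False
  interpret translated_free_polyhedron S B t
    using assms(4,5,7) False
    by unfold_locales (auto simp: maximal_free_convex_nbhd_def free_convex_nbhd_def)
  have id: "(+) (- t) ` (+) t ` X = X" for X :: "(real ^ 'n) set" by (simp add: image_image)
  interpret inverse: translated_free_polyhedron "(+) t ` S" "(+) t ` B" "- t"
    by unfold_locales (use zero in \<open>simp only: id\<close>)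
  have p': "p' = p + V p *\<^sub>R t" using assms(6,8) by simp
  \<comment> \<open>Since the lifting value is unchanged, translating by \<open>- t\<close> returns
    to \<open>p\<close>, and the converse is another instance of \<open>tr_covering\<close>.\<close>
  have p: "p' + tr.V p' *\<^sub>R - t = p" by (simp add: p' tr_V)
  show ?thesis
    using tr_covering[of p] inverse.tr_covering[of p'] unfolding p id by (auto simp only: p')
qed

end
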